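(* Let a finite Markov decision process be given, let $\mathcal U_F$ be the set of reward streams generated by its stationary policies, and let $\succsim$ be a preorder on the set $\mathcal U$ of all bounded real sequences. If $\succsim$ satisfies axioms A1, A5 and A8, then $\succsim$ and $\succsim_{\mathrm{AO}}$ coincide on $\mathcal U_F$; that is, for all $u,v\in\mathcal U_F$, $u\succsim v$ if and only if $u\succsim_{\mathrm{AO}}v$.
   Context: **Finite MDP.** $\mathcal S$ (states) and $\mathcal A$ (actions) are finite sets; for each $a\in\mathcal A$ there is a transition probability function $p_a(s'\mid s)$ on $\mathcal S$; and $r:\mathcal S\times\mathcal A\to\mathbb R$ is a reward function. $F$ is the set of all functions $f:\mathcal S\to\mathcal A$. For $f\in F$, $\mathbf Q(f)$ is the transition matrix with entries $\mathbf Q(f)_{s,s'}=p_{f(s)}(s'\mid s)$ and $\mathbf r(f)$ is the reward vector with entries $\mathbf r(f)_s=r(s,f(s))$. A policy is a sequence $\pi=(f_1,f_2,f_3,\dots)$ in $F$; it is stationary if it has the form $(f,f,f,\dots)$ for some $f\in F$. $\Pi_F$ is the set of stationary policies. For an initial state $s\in\mathcal S$ and a policy $\pi=(f_1,f_2,\dots)$, the generated stream $u(s,\pi)=(u_1,u_2,\dots)$ of expected rewards is $u_1=[\mathbf r(f_1)]_s$ and $u_t=[\mathbf Q(f_1)\cdots\mathbf Q(f_{t-1})\,\mathbf r(f_t)]_s$ for $t\ge 2$. $\mathcal U_F=\{u(s,\pi): s\in\mathcal S,\ \pi\in\Pi_F\}$. **Preferences.** $\mathcal U$ is the set of all bounded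 real sequences $u=(u_1,u_2,\dots)$. A preorder is a reflexive and transitive (not necessarily complete) binary relation $\succsim$. Write $u\succ v$ if $u\succsim v$ and not $v\succsim u$; write $u\sim v$ if $u\succsim v$ and $v\succsim u$. For $c\in\mathbb R$, $(c,u)=(c,u_1,u_2,\dots)$. The average of $u\in\mathcal U$ is $\bar u=\lim_{n\to\infty}\frac1n\sum_{t=1}^n u_t$; it is well defined if this limit exists. **Axioms.** - A1: for all $u,v\in\mathcal U$, if $u_t\ge v_t$ for all $t$ and $u_t>v_t$ for some $t$, then $u\succ v$. - A5: for all $u,v,\alpha\in\mathcal U$, if $u\succsim v$, then $u+\alpha\succsim v+\alpha$. - A8 (compensation principle): for every $u\in\mathcal U$, if $\bar u$ is well defined, then $(\bar u,u)\sim u$. **Average overtaking preorder.** With $\sigma_T(w)=\sum_{t=1}^T w_t$, $u\succsim_{\mathrm{AO}}v$ if and only if $\liminf_{T\to\infty}\frac1T\sum_{t=1}^T\sigma_t(u-v)\ge 0$. *)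

theory Defs
  imports "HOL-Analysis.Analysis"
begin

(* Sequences u_1, u_2, ... are functions nat => real indexed from 0: the value u t is u_{t+1}.
   A relation pr on sequences is a set of pairs; (u, v) \<in> pr reads "u is weakly preferred to v". *)

type_synonym rstream = "nat \<Rightarrow> real"

definition streams :: "rstream set" where
  "streams = {u. bounded (range u)}"

(* p a s s' is the probability p_a(s'|s) of moving from s to s' under action a;
   the finite state and action sets are the types 's and 'a. *)

definition transition_prob :: "('a::finite \<Rightarrow> 's::finite \<Rightarrow> 's \<Rightarrow> real) \<Rightarrow> bool" where
  "transition_prob p \<longleftrightarrow>
     (\<forall>a s s'. 0 \<le> p a s s') \<and> (\<forall>a s. (\<Sum>s'\<in>UNIV. p a s s') = 1)"

definition trans_mat ::
  "('a::finite \<Rightarrow> 's::finite \<Rightarrow> 's \<Rightarrow> real) \<Rightarrow> ('s \<Rightarrow> 'a) \<Rightarrow> real ^ 's ^ 's" where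
  "trans_mat p f = (\<chi> s s'. p (f s) s s')"

definition reward_vec :: "('s::finite \<Rightarrow> 'a::finite \<Rightarrow> real) \<Rightarrow> ('s \<Rightarrow> 'a) \<Rightarrow> real ^ 's" where
  "reward_vec r f = (\<chi> s. r s (f s))"

type_synonym ('s, 'a) policy = "nat \<Rightarrow> 's \<Rightarrow> 'a"

definition stationary_policies :: "('s::finite, 'a::finite) policy set" where
  "stationary_policies = {\<pi>. \<exists>f. \<pi> = (\<lambda>_. f)}"

primrec trans_prod ::
  "('a::finite \<Rightarrow> 's::finite \<Rightarrow> 's \<Rightarrow> real) \<Rightarrow> ('s, 'a) policy \<Rightarrow> nat \<Rightarrow> real ^ 's ^ 's" where
  "trans_prod p \<pi> 0 = mat 1"
| "trans_prod p \<pi> (Suc t) = trans_prod p \<pi> t ** trans_mat p (\<pi> t)"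

definition reward_stream ::
  "('a::finite \<Rightarrow> 's::finite \<Rightarrow> 's \<Rightarrow> real) \<Rightarrow> ('s \<Rightarrow> 'a \<Rightarrow> real) \<Rightarrow> 's \<Rightarrow> ('s, 'a) policy \<Rightarrow> rstream"
  where
  "reward_stream p r s \<pi> = (\<lambda>t. (trans_prod p \<pi> t *v reward_vec r (\<pi> t)) $ s)"

definition stationary_streams ::
  "('a::finite \<Rightarrow> 's::finite \<Rightarrow> 's \<Rightarrow> real) \<Rightarrow> ('s \<Rightarrow> 'a \<Rightarrow> real) \<Rightarrow> rstream set" where
  "stationary_streams p r = {reward_stream p r s \<pi> | s \<pi>. \<pi> \<in> stationary_policies}"

definition strictly_pref :: "rstream rel \<Rightarrow> rstream \<Rightarrow> rstream \<Rightarrow> bool" where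
  "strictly_pref pr u v \<longleftrightarrow> (u, v) \<in> pr \<and> (v, u) \<notin> pr"

definition indifferent :: "rstream rel \<Rightarrow> rstream \<Rightarrow> rstream \<Rightarrow> bool" where
  "indifferent pr u v \<longleftrightarrow> (u, v) \<in> pr \<and> (v, u) \<in> pr"

definition partial_sum :: "nat \<Rightarrow> rstream \<Rightarrow> real" where
  "partial_sum T w = (\<Sum>t<T. w t)"

definition has_average :: "rstream \<Rightarrow> bool" where
  "has_average u \<longleftrightarrow> convergent (\<lambda>n. partial_sum n u / real n)"

definition average :: "rstream \<Rightarrow> real" where
  "average u = lim (\<lambda>n. partial_sum n u / real n)"

definition axiom_A1 :: "rstream rel \<Rightarrow> bool" where
  "axiom_A1 pr \<longleftrightarrow>
     (\<forall>u\<in>streams. \<forall>v\<in>streams.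
        (\<forall>t. u t \<ge> v t) \<and> (\<exists>t. u t > v t) \<longrightarrow> strictly_pref pr u v)"

definition axiom_A5 :: "rstream rel \<Rightarrow> bool" where
  "axiom_A5 pr \<longleftrightarrow>
     (\<forall>u\<in>streams. \<forall>v\<in>streams. \<forall>\<alpha>\<in>streams.
        (u, v) \<in> pr \<longrightarrow> ((\<lambda>t. u t + \<alpha> t), (\<lambda>t. v t + \<alpha> t)) \<in> pr)"

(* case_nat c u is the sequence (c, u_1, u_2, ...). *)

definition axiom_A8 :: "rstream rel \<Rightarrow> bool" where
  "axiom_A8 pr \<longleftrightarrow>
     (\<forall>u\<in>streams. has_average u \<longrightarrow> indifferent pr (case_nat (average u) u) u)"

(* The lower limit is taken in the extended reals, since the averaged partial sums
   may be unbounded. *)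

definition average_overtaking :: "rstream rel" where
  "average_overtaking =
     {(u, v). u \<in> streams \<and> v \<in> streams \<and>
        liminf (\<lambda>T. ereal ((\<Sum>t=1..T. partial_sum t (\<lambda>i. u i - v i)) / real T)) \<ge> 0}"

end

theory Submission
  imports Defs "HOL-Real_Asymp.Real_Asymp"
begin

text \<open>
  By additivity, \<open>u \<succsim> v\<close> iff \<open>w = u - v \<succsim> 0\<close>. If the partial sums \<open>\<sigma>\<^sub>T\<close> of \<open>w\<close> are bounded with
  Cesaro limit \<open>L\<close>, the stream \<open>x\<^sub>T = L - \<sigma>\<^sub>T\<close> has average 0 and \<open>(0, x) - x = w - (L, 0, 0, \<dots>)\<close>,
  so the compensation principle gives \<open>w \<sim> (L, 0, 0, \<dots>)\<close>, and A1 decides the comparison by the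
  sign of \<open>L\<close>. If instead \<open>w - c\<close> has this property with \<open>c > 0\<close>, then \<open>w\<close> dominates a stream of the
  first kind with arbitrarily large \<open>L\<close>. For a stationary policy with transition matrix \<open>Q\<close>, the
  ergodic decomposition \<open>r = c + (h - Q h)\<close>, \<open>Q c = c\<close>, gives \<open>\<sigma>\<^sub>T = T c + h - Q\<^sup>T h\<close>;
  decomposing \<open>h\<close> in the same way yields the Cesaro limit of \<open>Q\<^sup>T h\<close>.
\<close>

section \<open>Streams with bounded, Cesaro-convergent partial sums\<close>

text \<open>\<open>L\<close> is the Cesaro, or (C,1), value of the series of \<open>w\<close>.
  Boundedness of the partial sums keeps their shifts in \<open>streams\<close>, where A8
  applies.\<close>

definition sums_on_average :: "rstream \<Rightarrow> real \<Rightarrow> bool" where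
  "sums_on_average w L \<longleftrightarrow> bounded (range (\<lambda>T. partial_sum T w)) \<and>
     (\<lambda>T. (\<Sum>t=1..T. partial_sum t w) / real T) \<longlonglongrightarrow> L"

lemma partial_sum_Suc: "partial_sum (Suc T) w = partial_sum T w + w T"
  by (simp add: partial_sum_def)

lemma partial_sum_add: "partial_sum T (\<lambda>t. u t + v t) = partial_sum T u + partial_sum T v"
  by (simp add: partial_sum_def sum.distrib)

lemma streams_iff: "u \<in> streams \<longleftrightarrow> (\<exists>B. \<forall>t. \<bar>u t\<bar> \<le> B)"
  by (auto simp: streams_def bounded_iff)

lemma streams_const [simp]: "(\<lambda>_. c) \<in> streams"
  by (auto simp: streams_iff)

lemma streams_add [simp]: "u \<in> streams \<Longrightarrow> v \<in> streams \<Longrightarrow> (\<lambda>t. u t + v t) \<in> streams"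
  unfolding streams_iff by (meson abs_triangle_ineq add_mono order_trans)

lemma streams_uminus [simp]: "u \<in> streams \<Longrightarrow> (\<lambda>t. - u t) \<in> streams"
  by (simp add: streams_iff)

lemma streams_diff [simp]: "u \<in> streams \<Longrightarrow> v \<in> streams \<Longrightarrow> (\<lambda>t. u t - v t) \<in> streams"
  using streams_add[OF _ streams_uminus] by simp

lemma streams_case_nat [simp]:
  assumes "u \<in> streams" shows "case_nat c u \<in> streams"
proof -
  obtain B where "\<bar>u t\<bar> \<le> B" for t
    using assms by (auto simp: streams_iff)
  then have "\<forall>t. \<bar>case_nat c u t\<bar> \<le> max \<bar>c\<bar> B"
    by (auto simp: le_max_iff_disj split: nat.split)
  then show ?thesis
    by (auto simp: streams_iff)
qed

text \<open>Each term is a difference of two consecutive partial sums, which are bounded.\<close>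

lemma sums_on_average_streams:
  assumes "sums_on_average w L" shows "w \<in> streams"
proof -
  have "(\<lambda>T. partial_sum T w) \<in> streams"
    using assms by (simp add: sums_on_average_def streams_def)
  then obtain B where "\<bar>partial_sum T w\<bar> \<le> B" for T
    by (auto simp: streams_iff)
  moreover have "\<bar>w t\<bar> \<le> \<bar>partial_sum (Suc t) w\<bar> + \<bar>partial_sum t w\<bar>" for t
    by (simp add: partial_sum_Suc)
  ultimately have "\<bar>w t\<bar> \<le> B + B" for t
    by (meson add_mono order_trans)
  then show ?thesis
    by (auto simp: streams_iff)
qed

lemma sums_on_average_add:
  assumes "sums_on_average u K" "sums_on_average v L"
  shows "sums_on_average (\<lambda>t. u t + v t) (K + L)"
  using assms bounded_plus_comp[of "\<lambda>T. partial_sum T u" UNIV "\<lambda>T. partial_sum T v"]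
    tendsto_add[of "\<lambda>T. (\<Sum>t=1..T. partial_sum t u) / real T" K _
      "\<lambda>T. (\<Sum>t=1..T. partial_sum t v) / real T" L]
  by (simp add: sums_on_average_def partial_sum_add sum.distrib add_divide_distrib)

lemma sums_on_average_uminus:
  assumes "sums_on_average u K"
  shows "sums_on_average (\<lambda>t. - u t) (- K)"
proof -
  have "partial_sum T (\<lambda>t. - u t) = - partial_sum T u" for T
    by (simp add: partial_sum_def sum_negf)
  then show ?thesis
    using assms tendsto_minus[of "\<lambda>T. (\<Sum>t=1..T. partial_sum t u) / real T" K]
    by (simp add: sums_on_average_def sum_negf bounded_iff)
qed

lemma sums_on_average_diff:
  assumes "sums_on_average u K" "sums_on_average v L"
  shows "sums_on_average (\<lambda>t. u t - v t) (K - L)"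
  using sums_on_average_add[OF assms(1) sums_on_average_uminus[OF assms(2)]] by simp

text \<open>The partial sums are constant from \<open>N\<close> on; the total deviation
  \<open>d\<close> of the earlier ones vanishes after division by \<open>T\<close>. This later
  serves to raise the Cesaro value of a stream by altering finitely many terms.\<close>

lemma sums_on_average_finite_support:
  assumes "\<And>t. t \<ge> N \<Longrightarrow> w t = 0"
  shows "sums_on_average w (partial_sum N w)"
proof -
  define l where "l = partial_sum N w"
  define d where "d = (\<Sum>t=1..N. partial_sum t w - l)"
  have const: "partial_sum T w = l" if "T \<ge> N" for T
    unfolding l_def partial_sum_def using that assms
    by (intro sum.mono_neutral_right) auto
  \<comment> \<open>The partial sums take only finitely many values.\<close>
  have "partial_sum T w \<in> (\<lambda>T. partial_sum T w) ` {..N}" for T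
    using const[of T] by (cases "T \<ge> N") (auto simp: l_def)
  then have "range (\<lambda>T. partial_sum T w) \<subseteq> (\<lambda>T. partial_sum T w) ` {..N}"
    by blast
  then have "bounded (range (\<lambda>T. partial_sum T w))"
    by (meson finite_atMost finite_imageI finite_imp_bounded bounded_subset)
  moreover have "\<forall>\<^sub>F T in sequentially. l + d / real T = (\<Sum>t=1..T. partial_sum t w) / real T"
    using eventually_ge_at_top[of "max N 1"]
  proof eventually_elim
    case (elim T)
    have "d = (\<Sum>t=1..T. partial_sum t w - l)"
      unfolding d_def using elim const by (intro sum.mono_neutral_left) auto
    then show ?case
      using elim by (simp add: sum_subtractf field_simps)
  qed
  moreover have "(\<lambda>T. l + d / real T) \<longlonglongrightarrow> l + 0"
    by (intro tendsto_intros lim_const_over_n)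
  ultimately show ?thesis
    using Lim_transform_eventually by (fastforce simp: sums_on_average_def l_def)
qed

section \<open>Average overtaking as a sign condition\<close>

text \<open>A constant \<open>c\<close> in each period adds \<open>c * (T + 1) / 2\<close> to the
  averaged partial sums, which outweighs the convergent remainder unless
  \<open>c = 0\<close>.\<close>

lemma average_overtaking_iff_nonneg:
  assumes u: "u \<in> streams" and v: "v \<in> streams"
    and w: "sums_on_average (\<lambda>t. u t - v t - c) L"
  shows "(u, v) \<in> average_overtaking \<longleftrightarrow> c > 0 \<or> (c = 0 \<and> L \<ge> 0)"
proof -
  define m where "m T = (\<Sum>t=1..T. partial_sum t (\<lambda>t. u t - v t - c)) / real T" for T
  define M where "M T = (\<Sum>t=1..T. partial_sum t (\<lambda>t. u t - v t)) / real T" for T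
  have m: "m \<longlonglongrightarrow> L"
    using w by (simp add: sums_on_average_def m_def[abs_def])
  have sum_id: "(\<Sum>t=1..T. real t) = real T * (real T + 1) / 2" for T
    by (induction T) (auto simp: field_simps)
  have psum: "partial_sum t (\<lambda>t. u t - v t) = partial_sum t (\<lambda>t. u t - v t - c) + c * real t" for t
    by (simp add: partial_sum_def sum_subtractf)
  have M: "\<forall>\<^sub>F T in sequentially. m T + c * ((real T + 1) / 2) = M T"
    using eventually_gt_at_top[of 0]
  proof eventually_elim
    case (elim T)
    then show ?case
      unfolding m_def M_def psum sum.distrib sum_distrib_left[symmetric] sum_id
      by (simp add: field_simps)
  qed
  have lin: "filterlim (\<lambda>T. (real T + 1) / 2) at_top sequentially"
    by real_asymp
  have ao: "(u, v) \<in> average_overtaking \<longleftrightarrow> liminf (\<lambda>T. ereal (M T)) \<ge> 0"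
    using u v by (simp add: average_overtaking_def M_def)
  consider "c = 0" | "c > 0" | "c < 0"
    by linarith
  then show ?thesis
  proof cases
    case 1
    then have "M \<longlonglongrightarrow> L"
      using Lim_transform_eventually[OF m] M by simp
    then have "liminf (\<lambda>T. ereal (M T)) = ereal L"
      by (intro lim_imp_Liminf) auto
    then show ?thesis
      using ao 1 by (simp add: zero_ereal_def)
  next
    case 2
    have "filterlim (\<lambda>T. m T + c * ((real T + 1) / 2)) at_top sequentially"
      by (intro filterlim_tendsto_add_at_top[OF m]
          filterlim_tendsto_pos_mult_at_top[OF tendsto_const 2] lin)
    then have "filterlim M at_top sequentially"
      using filterlim_cong[OF refl refl M] by simp
    then have "(\<lambda>T. ereal (M T)) \<longlonglongrightarrow> \<infinity>"
      by (simp add: tendsto_PInfty_eq_at_top)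
    then have "liminf (\<lambda>T. ereal (M T)) = \<infinity>"
      by (intro lim_imp_Liminf) auto
    then show ?thesis
      using ao 2 by simp
  next
    case 3
    have "filterlim (\<lambda>T. - m T + (- c) * ((real T + 1) / 2)) at_top sequentially"
      using 3 by (intro filterlim_tendsto_add_at_top[OF tendsto_minus[OF m]]
          filterlim_tendsto_pos_mult_at_top[OF tendsto_const] lin) simp
    then have "filterlim (\<lambda>T. m T + c * ((real T + 1) / 2)) at_bot sequentially"
      by (subst filterlim_uminus_at_bot) simp
    then have "filterlim M at_bot sequentially"
      using filterlim_cong[OF refl refl M] by simp
    then have "(\<lambda>T. ereal (M T)) \<longlonglongrightarrow> -\<infinity>"
      by (simp add: tendsto_MInfty filterlim_at_bot_dense)
    then have "liminf (\<lambda>T. ereal (M T)) = -\<infinity>"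
      by (intro lim_imp_Liminf) auto
    then show ?thesis
      using ao 3 by simp
  qed
qed

section \<open>Consequences of the axioms A1, A5 and A8\<close>

locale compensated_preorder =
  fixes pr :: "rstream rel"
  assumes preorder: "preorder_on streams pr"
    and A1: "axiom_A1 pr" and A5: "axiom_A5 pr" and A8: "axiom_A8 pr"
begin

lemma pref_trans: "(u, v) \<in> pr \<Longrightarrow> (v, w) \<in> pr \<Longrightarrow> (u, w) \<in> pr"
  using preorder by (auto simp: preorder_on_def dest: transD)

lemma pref_refl: "u \<in> streams \<Longrightarrow> (u, u) \<in> pr"
  using preorder by (auto simp: preorder_on_def refl_on_def)

lemma pref_add:
  "(u, v) \<in> pr \<Longrightarrow> u \<in> streams \<Longrightarrow> v \<in> streams \<Longrightarrow> a \<in> streams \<Longrightarrow>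
    ((\<lambda>t. u t + a t), (\<lambda>t. v t + a t)) \<in> pr"
  using A5 by (simp add: axiom_A5_def)

lemma pref_iff_diff:
  assumes "u \<in> streams" "v \<in> streams"
  shows "(u, v) \<in> pr \<longleftrightarrow> ((\<lambda>t. u t - v t), (\<lambda>_. 0)) \<in> pr"
proof
  assume "(u, v) \<in> pr"
  then show "((\<lambda>t. u t - v t), (\<lambda>_. 0)) \<in> pr"
    using pref_add[of u v "\<lambda>t. - v t"] assms by simp
next
  assume "((\<lambda>t. u t - v t), (\<lambda>_. 0)) \<in> pr"
  then show "(u, v) \<in> pr"
    using pref_add[of "\<lambda>t. u t - v t" "\<lambda>_. 0" v] assms by simp
qed

lemma strictly_pref_dominates:
  "u \<in> streams \<Longrightarrow> v \<in> streams \<Longrightarrow> (\<And>t. u t \<ge> v t) \<Longrightarrow> u t > v t \<Longrightarrow> strictly_pref pr u v"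
  using A1 unfolding axiom_A1_def by blast

lemma sums_on_average_indifferent:
  assumes w: "sums_on_average w L"
  shows "indifferent pr w (case_nat L (\<lambda>_. 0))"
proof -
  \<comment> \<open>Indices start at 0, so the first entry of \<open>x\<close> is already
    \<open>L - w 0\<close>.\<close>
  define x where "x t = L - partial_sum (Suc t) w" for t
  have "(\<lambda>t. partial_sum t w) \<in> streams"
    using w by (simp add: sums_on_average_def streams_def)
  then have "(\<lambda>t. partial_sum (Suc t) w) \<in> streams"
    unfolding streams_iff by blast
  then have xs: "x \<in> streams"
    unfolding x_def[abs_def] by simp
  have "\<forall>\<^sub>F n in sequentially.
      L - (\<Sum>t=1..n. partial_sum t w) / real n = partial_sum n x / real n"
    using eventually_gt_at_top[of 0]
  proof eventually_elim
    case (elim n)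
    have "partial_sum n x = real n * L - (\<Sum>t<n. partial_sum (Suc t) w)"
      by (simp add: partial_sum_def[of n x] x_def sum_subtractf)
    also have "(\<Sum>t<n. partial_sum (Suc t) w) = (\<Sum>t=1..n. partial_sum t w)"
      by (simp add: sum.atLeast1_atMost_eq)
    finally show ?case
      using elim by (simp add: field_simps)
  qed
  moreover have "(\<lambda>n. L - (\<Sum>t=1..n. partial_sum t w) / real n) \<longlonglongrightarrow> L - L"
    using w by (intro tendsto_diff tendsto_const) (simp add: sums_on_average_def)
  ultimately have "(\<lambda>n. partial_sum n x / real n) \<longlonglongrightarrow> 0"
    using Lim_transform_eventually by fastforce
  then have "has_average x" "average x = 0"
    by (auto simp: has_average_def average_def convergent_def limI)
  then have ind: "indifferent pr (case_nat 0 x) x"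
    using A8 xs by (force simp: axiom_A8_def)
  define e where "e = case_nat L (\<lambda>_. 0 :: real)"
  have es: "e \<in> streams"
    by (simp add: e_def)
  \<comment> \<open>At \<open>t = 0\<close> the term \<open>L\<close> of \<open>e\<close> cancels
    the one in \<open>x\<close>; later, consecutive entries of \<open>x\<close> differ by
    \<open>w t\<close>. Adding \<open>e - x\<close> thus turns \<open>(0, x)\<close> into
    \<open>w\<close> and \<open>x\<close> into \<open>e\<close>.\<close>
  have eq: "case_nat 0 x t + (e t - x t) = w t" for t
    by (cases t) (simp_all add: x_def e_def partial_sum_def)
  have "(w, e) \<in> pr"
    using ind pref_add[of "case_nat 0 x" x "\<lambda>t. e t - x t"] xs es
    by (simp add: indifferent_def eq)
  moreover have "(e, w) \<in> pr"
    using ind pref_add[of x "case_nat 0 x" "\<lambda>t. e t - x t"] xs es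
    by (simp add: indifferent_def eq)
  ultimately show ?thesis
    by (simp add: indifferent_def e_def)
qed

text \<open>The stream \<open>(L, 0, 0, \<dots>)\<close> replaces \<open>w\<close>, and it is
  pointwise comparable with zero.\<close>

lemma pref_zero_iff_sums_on_average:
  assumes w: "sums_on_average w L"
  shows "(w, \<lambda>_. 0) \<in> pr \<longleftrightarrow> L \<ge> 0"
proof -
  let ?e = "case_nat L (\<lambda>_. 0 :: real)"
  have ind: "(w, ?e) \<in> pr" "(?e, w) \<in> pr"
    using sums_on_average_indifferent[OF w] by (auto simp: indifferent_def)
  then have "(w, \<lambda>_. 0) \<in> pr \<longleftrightarrow> (?e, \<lambda>_. 0) \<in> pr"
    using pref_trans by blast
  also have "\<dots> \<longleftrightarrow> L \<ge> 0"
  proof (cases L "0 :: real" rule: linorder_cases)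
    case less
    then have "strictly_pref pr (\<lambda>_. 0) ?e"
      by (intro strictly_pref_dominates[where t = 0]) (auto split: nat.split)
    then show ?thesis
      using less by (simp add: strictly_pref_def)
  next
    case equal
    then have "?e = (\<lambda>_. 0)"
      by (auto split: nat.split)
    then show ?thesis
      using equal pref_refl by simp
  next
    case greater
    then have "strictly_pref pr ?e (\<lambda>_. 0)"
      by (intro strictly_pref_dominates[where t = 0]) (auto split: nat.split)
    then show ?thesis
      using greater by (simp add: strictly_pref_def)
  qed
  finally show ?thesis .
qed

lemma strictly_pref_zero_of_positive_average:
  assumes w: "sums_on_average (\<lambda>t. w t - c) L" and c: "c > 0"
  shows "strictly_pref pr w (\<lambda>_. 0)"
proof -
  \<comment> \<open>Enough periods for the Cesaro value \<open>L + n * c\<close> of \<open>g\<close>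
    to be positive.\<close>
  obtain n where n: "real n * c > - L"
    using reals_Archimedean3[OF c] by blast
  define f where "f t = (if t < n then c else 0)" for t
  \<comment> \<open>\<open>g\<close> agrees with \<open>w\<close> before time \<open>n\<close> and
    equals \<open>w - c\<close> from then on, so \<open>w\<close> dominates it, strictly at
    \<open>n\<close>.\<close>
  define g where "g t = w t - c + f t" for t
  have ws: "w \<in> streams"
    using streams_add[OF sums_on_average_streams[OF w] streams_const[of c]] by simp
  have "sums_on_average f (partial_sum n f)"
    by (rule sums_on_average_finite_support) (simp add: f_def)
  then have "sums_on_average f (real n * c)"
    by (simp add: partial_sum_def f_def)
  then have g: "sums_on_average g (L + real n * c)"
    unfolding g_def[abs_def] by (rule sums_on_average_add[OF w])
  then have "(g, \<lambda>_. 0) \<in> pr"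
    using pref_zero_iff_sums_on_average n by simp
  moreover have "strictly_pref pr w g"
    using c by (intro strictly_pref_dominates[where t = n] ws sums_on_average_streams[OF g])
      (auto simp: g_def f_def)
  ultimately show ?thesis
    using pref_trans unfolding strictly_pref_def by blast
qed

lemma pref_zero_iff:
  assumes w: "sums_on_average (\<lambda>t. w t - c) L"
  shows "(w, \<lambda>_. 0) \<in> pr \<longleftrightarrow> c > 0 \<or> (c = 0 \<and> L \<ge> 0)"
proof (cases c "0 :: real" rule: linorder_cases)
  case less
  have ws: "w \<in> streams"
    using streams_add[OF sums_on_average_streams[OF w] streams_const[of c]] by simp
  \<comment> \<open>The positive case applies to \<open>- w\<close>; by A5, \<open>w\<close> weakly
    preferred to zero would make zero weakly preferred to \<open>- w\<close>.\<close>
  have "sums_on_average (\<lambda>t. - w t - (- c)) (- L)"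
    using sums_on_average_uminus[OF w] by simp
  then have "strictly_pref pr (\<lambda>t. - w t) (\<lambda>_. 0)"
    by (rule strictly_pref_zero_of_positive_average) (use less in simp)
  then have "(\<lambda>_. 0, \<lambda>t. - w t) \<notin> pr"
    by (simp add: strictly_pref_def)
  then have "(w, \<lambda>_. 0) \<notin> pr"
    using pref_iff_diff[of "\<lambda>_. 0" "\<lambda>t. - w t"] ws by simp
  then show ?thesis
    using less by simp
next
  case equal
  then show ?thesis
    using pref_zero_iff_sums_on_average w by simp
next
  case greater
  then show ?thesis
    using strictly_pref_zero_of_positive_average[OF w] by (simp add: strictly_pref_def)
qed

end

section \<open>Ergodic decomposition for power-bounded linear maps\<close>

lemma funpow_linear:
  fixes f :: "'a::real_vector \<Rightarrow> 'a"
  shows "linear f \<Longrightarrow> linear (f ^^ n)"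
  by (induction n) (auto simp: linear_id[unfolded id_def] id_def intro: linear_compose)

text \<open>If \<open>f y = y\<close> and \<open>y = x - f x\<close>, then \<open>n y = x - f\<^sup>n x\<close> is bounded, so \<open>y = 0\<close>. Hence
  \<open>id - f\<close> is injective, and by dimension surjective, on its own range.\<close>

lemma ergodic_decomposition:
  fixes f :: "'a::euclidean_space \<Rightarrow> 'a"
  assumes f: "linear f" and bdd: "\<And>x. bounded (range (\<lambda>n. (f ^^ n) x))"
  obtains c h where "f c = c" "x = c + (h - f h)"
proof -
  define g where "g x = x - f x" for x
  have g: "linear g"
    unfolding g_def[abs_def] by (intro linear_compose_sub linear_id[unfolded id_def] f)
  have zero: "g x = 0" if fix_g: "f (g x) = g x" for x
  proof -
    have fixn: "(f ^^ n) (g x) = g x" for n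
      by (induction n) (simp_all add: fix_g)
    have eq: "real n *\<^sub>R g x = x - (f ^^ n) x" for n
    proof (induction n)
      case (Suc n)
      have "(f ^^ n) (g x) = (f ^^ n) x - (f ^^ Suc n) x"
        by (simp add: g_def linear_diff[OF funpow_linear[OF f]] funpow_swap1)
      then have "g x = (f ^^ n) x - (f ^^ Suc n) x"
        by (simp only: fixn)
      then have "real (Suc n) *\<^sub>R g x = ((f ^^ n) x - (f ^^ Suc n) x) + (x - (f ^^ n) x)"
        unfolding Suc[symmetric] by (simp add: scaleR_add_left)
      then show ?case
        by simp
    qed auto
    obtain B where B: "norm ((f ^^ n) x) \<le> B" for n
      using bdd[of x] by (auto simp: bounded_iff)
    have "real n * norm (g x) \<le> norm x + B" for n
    proof -
      have "real n * norm (g x) = norm (x - (f ^^ n) x)"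
        using arg_cong[OF eq[of n], of norm] by simp
      then show ?thesis
        using norm_triangle_ineq4[of x "(f ^^ n) x"] B[of n] by linarith
    qed
    then show ?thesis
      by (metis linorder_not_le reals_Archimedean3 zero_less_norm_iff)
  qed
  have sub: "subspace (range g)"
    using g by (intro linear_subspace_image) auto
  have "inj_on g (range g)"
    unfolding linear_inj_on_iff_eq_0[OF g sub]
  proof
    fix y assume "y \<in> range g"
    then show "g y = 0 \<longrightarrow> y = 0"
      using zero by (auto simp: g_def)
  qed
  then have "dim (g ` range g) = dim (range g)"
    using dim_image_eq[OF g] sub by (simp add: span_eq_iff[THEN iffD2])
  then have "g ` range g = range g"
    by (intro subspace_dim_equal linear_subspace_image[OF g] sub) auto
  then obtain h where "g x = g (g h)"
    by (metis (mono_tags, lifting) imageE rangeI)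
  then have "g (x - g h) = 0"
    by (simp add: linear_diff[OF g])
  then show ?thesis
    \<comment> \<open>The kernel of \<open>g\<close> consists of the fixed points of
      \<open>f\<close>, so \<open>x - g h\<close> is the invariant part.\<close>
    using that[of "x - g h" h] by (simp add: g_def algebra_simps)
qed

section \<open>Reward streams of stationary policies\<close>

text \<open>\<open>trans_prod\<close> appends its new factor on the right, next to \<open>x\<close>;
  the induction therefore needs \<open>x\<close> arbitrary.\<close>

lemma trans_prod_stationary:
  "trans_prod p (\<lambda>_. f) t *v x = (((*v) (trans_mat p f)) ^^ t) x"
  by (induction t arbitrary: x) (simp_all add: matrix_vector_mul_assoc[symmetric] funpow_swap1)

text \<open>Each row is a probability vector, so entries of the product are weighted means of the
  entries of \<open>x\<close>.\<close>

lemma abs_trans_mat_mult_le: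
  assumes p: "transition_prob p" and x: "\<And>s. \<bar>x $ s\<bar> \<le> B"
  shows "\<bar>(trans_mat p f *v x) $ s\<bar> \<le> B"
proof -
  have "\<bar>(trans_mat p f *v x) $ s\<bar> \<le> (\<Sum>s'\<in>UNIV. \<bar>p (f s) s s' * x $ s'\<bar>)"
    by (simp add: matrix_vector_mult_def trans_mat_def sum_abs)
  also have "\<dots> \<le> (\<Sum>s'\<in>UNIV. p (f s) s s' * B)"
    using p x by (intro sum_mono) (simp add: transition_prob_def abs_mult mult_left_mono)
  also have "\<dots> = B"
    using p by (simp add: transition_prob_def sum_distrib_right[symmetric])
  finally show ?thesis .
qed

text \<open>This gives the power-boundedness that the ergodic decomposition requires.\<close>

lemma abs_trans_mat_funpow_le:
  assumes p: "transition_prob p"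
  shows "\<bar>((((*v) (trans_mat p f)) ^^ t) x) $ s\<bar> \<le> norm x"
proof (induction t arbitrary: s)
  case 0
  then show ?case
    by (simp add: component_le_norm_cart)
next
  case (Suc t)
  then show ?case
    using abs_trans_mat_mult_le[OF p] by simp
qed

text \<open>The witnesses are the gain (long-run average reward) and the bias of the policy at state
  \<open>s\<close>.\<close>

lemma stationary_sums_on_average:
  assumes p: "transition_prob p" and u: "u \<in> stationary_streams p r"
  obtains c L where "sums_on_average (\<lambda>t. u t - c) L"
proof -
  obtain f s where u_eq: "u = reward_stream p r s (\<lambda>_. f)"
    using u by (auto simp: stationary_streams_def stationary_policies_def)
  define Q where "Q = (*v) (trans_mat p f)"
  have lin: "linear Q"
    unfolding Q_def by simp
  have le: "\<bar>(Q ^^ t) x $ s'\<bar> \<le> norm x" for t x s'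
    unfolding Q_def by (rule abs_trans_mat_funpow_le[OF p])
  have "norm ((Q ^^ t) x) \<le> (\<Sum>i\<in>(UNIV :: 'b set). norm x)" for t x
    by (rule order_trans[OF norm_le_l1_cart sum_mono[OF le]])
  then have bdd: "bounded (range (\<lambda>t. (Q ^^ t) x))" for x
    unfolding bounded_iff by blast
  obtain c h where c: "Q c = c" and r: "reward_vec r f = c + (h - Q h)"
    using ergodic_decomposition[OF lin bdd] .
  \<comment> \<open>\<open>d\<close> is the Cesaro limit of \<open>(Q ^^ t) h\<close>, which itself
    need not converge if the chain is periodic.\<close>
  obtain d k where d: "Q d = d" and h: "h = d + (k - Q k)"
    using ergodic_decomposition[OF lin bdd] .
  have pow: "(Q ^^ t) (a + (b - Q b)) = a + ((Q ^^ t) b - (Q ^^ Suc t) b)" if "Q a = a" for a b t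
  proof -
    have "(Q ^^ t) a = a"
      by (induction t) (simp_all add: that)
    then show ?thesis
      by (simp add: linear_add[OF funpow_linear[OF lin]] linear_diff[OF funpow_linear[OF lin]]
          funpow_swap1)
  qed
  define w where "w t = u t - c $ s" for t
  have w: "w t = (Q ^^ t) h $ s - (Q ^^ Suc t) h $ s" for t
    unfolding w_def u_eq reward_stream_def trans_prod_stationary Q_def[symmetric] r pow[OF c]
    by simp
  have psum: "partial_sum T w = h $ s - (Q ^^ T) h $ s" for T
    by (induction T) (simp_all add: partial_sum_Suc w partial_sum_def[of 0])
  have "\<bar>partial_sum T w\<bar> \<le> norm h + norm h" for T
    using le[of T h s] component_le_norm_cart[of h s] by (simp add: psum)
  then have "bounded (range (\<lambda>T. partial_sum T w))"
    by (auto simp: bounded_iff)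
  moreover have "(\<lambda>T. (\<Sum>t=1..T. partial_sum t w) / real T) \<longlonglongrightarrow> h $ s - d $ s"
  proof -
    have "(Q ^^ t) h = d + ((Q ^^ t) k - (Q ^^ Suc t) k)" for t
      unfolding h by (rule pow[OF d])
    then have comp: "(Q ^^ t) h $ s = d $ s + ((Q ^^ t) k $ s - (Q ^^ Suc t) k $ s)" for t
      by simp
    \<comment> \<open>The terms in \<open>k\<close> telescope to a bounded remainder, which division
      by \<open>T\<close> removes.\<close>
    have sum: "(\<Sum>t=1..T. partial_sum t w) =
        real T * (h $ s - d $ s) + ((Q ^^ Suc T) k $ s - Q k $ s)" for T
      by (induction T) (simp_all add: psum comp algebra_simps del: funpow.simps(2), simp)
    have "\<forall>\<^sub>F T in sequentially. h $ s - d $ s + ((Q ^^ Suc T) k $ s - Q k $ s) * inverse (real T) =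
        (\<Sum>t=1..T. partial_sum t w) / real T"
      using eventually_gt_at_top[of 0]
      by eventually_elim (simp only: sum, simp add: field_simps)
    moreover have "(\<lambda>T. ((Q ^^ Suc T) k $ s - Q k $ s) * inverse (real T)) \<longlonglongrightarrow> 0"
    proof (rule lim_null_mult_left_bounded)
      have "norm ((Q ^^ Suc T) k $ s - Q k $ s) \<le> norm k + norm k" for T
        using le[of "Suc T" k s] le[of 1 k s] by simp
      then show "\<forall>\<^sub>F T in sequentially. norm ((Q ^^ Suc T) k $ s - Q k $ s) \<le> norm k + norm k"
        by simp
    qed (rule lim_inverse_n)
    ultimately show ?thesis
      using Lim_transform_eventually tendsto_add[OF tendsto_const] by fastforce
  qed
  ultimately have "sums_on_average w (h $ s - d $ s)"
    by (simp add: sums_on_average_def)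
  then show ?thesis
    using that unfolding w_def[abs_def] by blast
qed

theorem theorem3:
  fixes p :: "'a::finite \<Rightarrow> 's::finite \<Rightarrow> 's \<Rightarrow> real"
    and r :: "'s \<Rightarrow> 'a \<Rightarrow> real"
    and pr :: "rstream rel"
  assumes "transition_prob p"
    and "preorder_on streams pr"
    and "axiom_A1 pr" and "axiom_A5 pr" and "axiom_A8 pr"
  shows "\<forall>u\<in>stationary_streams p r. \<forall>v\<in>stationary_streams p r.
           (u, v) \<in> pr \<longleftrightarrow> (u, v) \<in> average_overtaking"
proof (intro ballI)
  fix u v assume u: "u \<in> stationary_streams p r" and v: "v \<in> stationary_streams p r"
  interpret compensated_preorder pr
    using assms by unfold_locales
  obtain a K where a: "sums_on_average (\<lambda>t. u t - a) K"
    using stationary_sums_on_average[OF assms(1) u] .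
  obtain b L where b: "sums_on_average (\<lambda>t. v t - b) L"
    using stationary_sums_on_average[OF assms(1) v] .
  have us: "u \<in> streams" and vs: "v \<in> streams"
    using streams_add[OF sums_on_average_streams[OF a] streams_const[of a]]
      streams_add[OF sums_on_average_streams[OF b] streams_const[of b]] by simp_all
  have w: "sums_on_average (\<lambda>t. u t - v t - (a - b)) (K - L)"
    using sums_on_average_diff[OF a b] by (simp add: algebra_simps)
  \<comment> \<open>Both relations reduce to the same lexicographic sign condition on
    \<open>a - b\<close> and \<open>K - L\<close>.\<close>
  show "(u, v) \<in> pr \<longleftrightarrow> (u, v) \<in> average_overtaking"
    unfolding pref_iff_diff[OF us vs] pref_zero_iff[OF w]
      average_overtaking_iff_nonneg[OF us vs w] ..
qed

end
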